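(* Let $G$ be a simple connected graph and $0\le\alpha\le 1$. Then $$\rho(G)\geq\frac{\alpha Tr_{\min}+\sqrt{\alpha^{2}Tr_{\min}^{2}+4(1-\alpha)T_{\min}}}{2},$$ where $Tr_{\min}$ and $T_{\min}$ are the minimum transmission degree and the minimum second transmission degree of $G$. Moreover, equality holds if and only if $G$ is transmission regular.
   Context: For a connected graph $G$ with vertices $v_1,\ldots,v_n$ and distances $d_{ij}=d(v_i,v_j)$, the transmission degree is $Tr_i=\sum_j d_{ij}$ and the second transmission degree is $T_i=\sum_j d_{ij}Tr_j$. $G$ is transmission regular if all $Tr_i$ are equal. The generalized distance matrix is $\mathcal{D}_\alpha(G)=\alpha\,Tr(G)+(1-\alpha)\mathcal{D}(G)$, where $\mathcal{D}(G)=(d_{ij})$ and $Tr(G)=\mathrm{diag}(Tr_1,\ldots,Tr_n)$; $\rho(G)$ is its largest eigenvalue. *)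

theory Defs
  imports "Graph_Theory.Graph_Theory" "Jordan_Normal_Form.Char_Poly"
begin

text \<open>
  A simple graph is the locale \<^locale>\<open>graph\<close>: a finite, loop-free digraph without parallel arcs
  whose arc relation is symmetric, so that an edge is a pair of opposite arcs. The library's
  \<^const>\<open>connected\<close> includes that the vertex set is nonempty; the one-vertex graph is allowed.
\<close>

text \<open>
  With unit arc costs, the infimal walk cost is the number of edges of a shortest walk. It is
  infinite (and collapses to 0 here) only for vertices in different components, which does not
  occur in a connected graph.
\<close>

definition gdist :: "('a, 'b) pre_digraph \<Rightarrow> 'a \<Rightarrow> 'a \<Rightarrow> real" where
  "gdist G u v = real_of_ereal (wf_digraph.\<mu> G (\<lambda>_. 1) u v)"

definition transmission :: "('a, 'b) pre_digraph \<Rightarrow> 'a \<Rightarrow> real" where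
  "transmission G u = (\<Sum>v\<in>verts G. gdist G u v)"

definition second_transmission :: "('a, 'b) pre_digraph \<Rightarrow> 'a \<Rightarrow> real" where
  "second_transmission G u = (\<Sum>v\<in>verts G. gdist G u v * transmission G v)"

definition transmission_min :: "('a, 'b) pre_digraph \<Rightarrow> real" where
  "transmission_min G = Min (transmission G ` verts G)"

definition second_transmission_min :: "('a, 'b) pre_digraph \<Rightarrow> real" where
  "second_transmission_min G = Min (second_transmission G ` verts G)"

definition transmission_regular :: "('a, 'b) pre_digraph \<Rightarrow> bool" where
  "transmission_regular G \<longleftrightarrow> (\<forall>u\<in>verts G. \<forall>v\<in>verts G. transmission G u = transmission G v)"

text \<open>
  In the matrices below, the list \<open>vs\<close> is the chosen numbering of the vertices: it is meant to
  contain every vertex of \<open>G\<close> exactly once.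
\<close>

definition distance_mat :: "('a, 'b) pre_digraph \<Rightarrow> 'a list \<Rightarrow> real mat" where
  "distance_mat G vs = mat (length vs) (length vs) (\<lambda>(i, j). gdist G (vs ! i) (vs ! j))"

definition transmission_mat :: "('a, 'b) pre_digraph \<Rightarrow> 'a list \<Rightarrow> real mat" where
  "transmission_mat G vs = mat_diag (length vs) (\<lambda>i. transmission G (vs ! i))"

definition gen_distance_mat :: "real \<Rightarrow> ('a, 'b) pre_digraph \<Rightarrow> 'a list \<Rightarrow> real mat" where
  "gen_distance_mat \<alpha> G vs =
     \<alpha> \<cdot>\<^sub>m transmission_mat G vs + (1 - \<alpha>) \<cdot>\<^sub>m distance_mat G vs"

text \<open>
  The matrices to which this is applied are real symmetric, so their spectrum is real and nothing
  is lost by taking eigenvalues over the reals.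
\<close>

definition largest_eigenvalue :: "real mat \<Rightarrow> real" where
  "largest_eigenvalue A = Max {k. eigenvalue A k}"

end

theory Submission
  imports Defs "HOL-Analysis.Function_Topology"
begin

text \<open>
  The matrix $A = D_{\alpha}(G)$ has row sums $Tr_i$, and $A^2$ has row sums
  $\alpha Tr_i^2 + (1 - \alpha) T_i \ge \alpha Tr_{\min} Tr_i + (1 - \alpha) T_{\min}$. Weighting these
  inequalities by a nonnegative eigenvector of $A$ for $\rho$ gives
  $\rho^2 \ge \alpha Tr_{\min}\, \rho + (1 - \alpha) T_{\min}$, which is the bound. If equality holds and
  $\alpha < 1$, the eigenvector is positive, so every $T_i$ equals $T_{\min}$, and a connected graph
  with constant second transmission is transmission regular; if $\alpha = 1$, then $A$ is diagonal
  and $\rho$ is the largest transmission.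
\<close>

section \<open>Distances in connected graphs\<close>

lemma (in wf_digraph) awalk_cost_unit: "awalk_cost (\<lambda>_. 1) p = real (length p)"
  by (induction p) auto

text \<open>Every arc has an opposite arc, and the opposites in reverse order form a walk back. This
  is what makes \<open>gdist\<close> symmetric.\<close>

lemma (in sym_digraph) awalk_reverse:
  assumes "awalk u p v"
  shows "\<exists>q. awalk v q u \<and> length q = length p"
  using assms
proof (induction p arbitrary: u)
  case Nil
  then show ?case by (auto simp: awalk_Nil_iff)
next
  case (Cons e es)
  then have e: "e \<in> arcs G" "tail G e = u" and "awalk (head G e) es v"
    by (auto simp: awalk_Cons_iff)
  then obtain q where q: "awalk v q (head G e)" "length q = length es"
    using Cons.IH by blast
  have "(head G e, u) \<in> arcs_ends G"
    using e arcs_ends_symmetric[of G u "head G e"] sym_arcs by (auto simp: arcs_ends_conv)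
  then obtain e' where "e' \<in> arcs G" "tail G e' = head G e" "head G e' = u"
    by (auto simp: arcs_ends_conv)
  then have "awalk (head G e) [e'] u"
    by (auto simp: awalk_Cons_iff awalk_Nil_iff)
  then have "awalk v (q @ [e']) u"
    using q by (auto intro: awalk_appendI)
  with q show ?case
    by (intro exI[of _ "q @ [e']"]) auto
qed

lemma (in sym_digraph) \<mu>_unit_commute: "\<mu> (\<lambda>_. 1) u v = \<mu> (\<lambda>_. 1) v u"
proof -
  have "\<mu> (\<lambda>_. 1) x y \<le> \<mu> (\<lambda>_. 1) y x" for x y
    unfolding \<mu>_def
  proof (rule INF_mono)
    fix p assume "p \<in> {p. awalk y p x}"
    then obtain q where "awalk x q y" "length q = length p"
      using awalk_reverse by blast
    then show "\<exists>q\<in>{q. awalk x q y}. ereal (awalk_cost (\<lambda>_. 1) q) \<le> ereal (awalk_cost (\<lambda>_. 1) p)"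
      by (intro bexI[of _ q]) (simp_all add: awalk_cost_unit)
  qed
  then show ?thesis by (intro antisym)
qed

lemma (in wf_digraph) \<mu>_unit_nonneg: "0 \<le> \<mu> (\<lambda>_. 1) u v"
  unfolding \<mu>_def by (intro INF_greatest) (simp add: awalk_cost_unit)

lemma (in wf_digraph) \<mu>_unit_ge_one:
  assumes "u \<noteq> v"
  shows "1 \<le> \<mu> (\<lambda>_. 1) u v"
  unfolding \<mu>_def
proof (intro INF_greatest)
  fix p assume "p \<in> {p. awalk u p v}"
  with assms have "p \<noteq> []" by (auto simp: awalk_Nil_iff)
  then have "1 \<le> length p" by (cases p) auto
  then show "1 \<le> ereal (awalk_cost (\<lambda>_. 1) p)"
    by (simp add: awalk_cost_unit)
qed

lemma (in sym_digraph) gdist_commute: "gdist G u v = gdist G v u"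
  by (simp add: gdist_def \<mu>_unit_commute[of u v])

lemma (in wf_digraph) gdist_nonneg: "0 \<le> gdist G u v"
  by (simp add: gdist_def \<mu>_unit_nonneg real_of_ereal_pos)

lemma (in wf_digraph) gdist_self:
  assumes "u \<in> verts G"
  shows "gdist G u u = 0"
proof -
  have "\<mu> (\<lambda>_. 1) u u \<le> 0"
    using min_cost_le_walk_cost[of u "[]" u "\<lambda>_. 1"] assms
    by (simp add: awalk_Nil_iff zero_ereal_def)
  then have "\<mu> (\<lambda>_. 1) u u = 0" using \<mu>_unit_nonneg by (intro antisym)
  then show ?thesis by (simp add: gdist_def)
qed

text \<open>Since \<open>real_of_ereal\<close> sends infinity to 0, the lower bound 1 on the cost
  does not settle this by itself: connectedness supplies a walk, so the cost is finite and the bound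
  survives the conversion to reals.\<close>

lemma (in sym_digraph) gdist_pos:
  assumes "connected G" "u \<in> verts G" "v \<in> verts G" "u \<noteq> v"
  shows "0 < gdist G u v"
proof -
  have "strongly_connected G"
    using assms(1) sym_arcs by (intro symmetric_connected_imp_strongly_connected)
  then have "u \<rightarrow>\<^sup>* v" using assms by (auto simp: strongly_connected_def)
  then obtain p where "awalk u p v" by (auto simp: reachable_awalk)
  then have "\<mu> (\<lambda>_. 1) u v \<le> ereal (real (length p))"
    using min_cost_le_walk_cost[of u p v "\<lambda>_. 1"] by (simp add: awalk_cost_unit)
  moreover have "1 \<le> \<mu> (\<lambda>_. 1) u v" using assms by (intro \<mu>_unit_ge_one)
  ultimately show ?thesis
    unfolding gdist_def by (cases "\<mu> (\<lambda>_. 1) u v") auto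
qed

section \<open>Eigenvectors of symmetric nonnegative matrices\<close>

text \<open>Vectors are total functions with the product topology. Being 0 outside \<open>V\<close>
  confines the set to a product of copies of [0, 1] and {0}, which is compact by Tychonoff; the
  normalisation cuts out a closed subset.\<close>

lemma compact_nonneg_unit_sphere:
  assumes "finite V"
  shows "compact {x :: 'a \<Rightarrow> real. (\<forall>i\<in>V. 0 \<le> x i) \<and> (\<forall>i. i \<notin> V \<longrightarrow> x i = 0) \<and> (\<Sum>i\<in>V. (x i)\<^sup>2) = 1}"
    (is "compact ?K")
proof -
  define B where "B i = (if i \<in> V then {0..1} else {0 :: real})" for i
  have "compactin (product_topology (\<lambda>i. euclidean) UNIV) (PiE UNIV B)"
    unfolding compactin_PiE by (auto simp: B_def)
  then have "compact (PiE UNIV B)"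
    by (simp add: euclidean_product_topology)
  moreover have "closed {x :: 'a \<Rightarrow> real. (\<Sum>i\<in>V. (x i)\<^sup>2) = 1}"
    by (intro closed_Collect_eq continuous_intros) auto
  moreover have "?K = PiE UNIV B \<inter> {x. (\<Sum>i\<in>V. (x i)\<^sup>2) = 1}"
  proof -
    have "x i \<le> 1" if "(\<Sum>i\<in>V. (x i)\<^sup>2) = 1" "i \<in> V" for x :: "'a \<Rightarrow> real" and i
      using member_le_sum[OF that(2), of "\<lambda>i. (x i)\<^sup>2"] that assms
      by (simp add: abs_square_le_1 abs_le_iff)
    then show ?thesis
      by (fastforce simp: B_def PiE_def Pi_def split: if_splits)
  qed
  ultimately show ?thesis by (simp add: compact_Int_closed)
qed

text \<open>This is the first-order condition at the minimum t = 0, in a form that avoids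
  derivatives.\<close>

lemma nonneg_on_lin_quad_imp_zero:
  fixes b c :: real
  assumes "\<And>t. 0 \<le> 2 * t * b + t\<^sup>2 * c"
  shows "b = 0"
proof (rule ccontr)
  assume "b \<noteq> 0"
  \<comment> \<open>At t = -b / s the expression, scaled by the square of s, is b^2 (c - 2 s); this
    choice of \<open>s\<close> makes the second factor negative.\<close>
  define s where "s = \<bar>c\<bar> + 1"
  then have "s \<noteq> 0" by linarith
  have "0 \<le> (2 * (- b / s) * b + (- b / s)\<^sup>2 * c) * s\<^sup>2"
    by (intro mult_nonneg_nonneg assms) auto
  also have "\<dots> = b\<^sup>2 * (c - 2 * s)"
    using \<open>s \<noteq> 0\<close> by (simp add: field_simps power2_eq_square)
  finally have "0 \<le> c - 2 * s" using \<open>b \<noteq> 0\<close> by (simp add: zero_le_mult_iff)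
  then show False using abs_ge_self[of c] abs_ge_zero[of c] unfolding s_def by argo
qed

text \<open>A maximiser of the Rayleigh quotient among nonnegative vectors is a global one,
  because passing to absolute values does not decrease the quadratic form.\<close>

lemma symmetric_nonneg_top_eigenvector:
  fixes a :: "'a \<Rightarrow> 'a \<Rightarrow> real"
  assumes "finite V" "V \<noteq> {}"
    and sym: "\<And>i j. i \<in> V \<Longrightarrow> j \<in> V \<Longrightarrow> a i j = a j i"
    and nonneg: "\<And>i j. i \<in> V \<Longrightarrow> j \<in> V \<Longrightarrow> 0 \<le> a i j"
  obtains m x where "\<forall>i\<in>V. 0 \<le> x i" "\<exists>i\<in>V. x i \<noteq> 0"
    "\<forall>i\<in>V. (\<Sum>j\<in>V. a i j * x j) = m * x i"
    "\<forall>y. (\<Sum>i\<in>V. \<Sum>j\<in>V. a i j * y i * y j) \<le> m * (\<Sum>i\<in>V. (y i)\<^sup>2)"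
proof -
  define q where "q y = (\<Sum>i\<in>V. \<Sum>j\<in>V. a i j * y i * y j)" for y
  define N where "N y = (\<Sum>i\<in>V. (y i)\<^sup>2)" for y :: "'a \<Rightarrow> real"
  define K where "K = {x :: 'a \<Rightarrow> real. (\<forall>i\<in>V. 0 \<le> x i) \<and> (\<forall>i. i \<notin> V \<longrightarrow> x i = 0) \<and> N x = 1}"
  have "compact K"
    unfolding K_def N_def using \<open>finite V\<close> by (rule compact_nonneg_unit_sphere)
  moreover have "K \<noteq> {}"
  proof -
    obtain v where "v \<in> V" using \<open>V \<noteq> {}\<close> by blast
    then have "(\<lambda>i. if i = v then 1 else 0) \<in> K"
      using \<open>finite V\<close> by (auto simp: K_def N_def if_distrib[of "\<lambda>c. c\<^sup>2"] cong: if_cong)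
    then show ?thesis by blast
  qed
  moreover have "continuous_on K q"
    unfolding q_def
    by (intro continuous_intros continuous_on_subset[OF continuous_on_product_coordinates]) auto
  ultimately obtain x where x: "x \<in> K" and max: "\<And>y. y \<in> K \<Longrightarrow> q y \<le> q x"
    using continuous_attains_sup[of K q] by blast
  define m where "m = q x"
  have rayleigh: "q y \<le> m * N y" for y
  proof (cases "N y = 0")
    case True
    then have "\<forall>i\<in>V. y i = 0"
      using \<open>finite V\<close> by (simp add: N_def sum_nonneg_eq_0_iff)
    then have "q y = 0" by (simp add: q_def)
    with True show ?thesis by simp
  next
    case False
    moreover have "0 \<le> N y" by (simp add: N_def sum_nonneg)
    ultimately have pos: "0 < N y" by simp
    \<comment> \<open>The absolute values of \<open>y\<close> are scaled to \<open>N z = 1\<close>;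
      membership in \<open>K\<close> also demands the value 0 outside \<open>V\<close>.\<close>
    define z where "z i = (if i \<in> V then \<bar>y i\<bar> / sqrt (N y) else 0)" for i
    have "N z = (\<Sum>i\<in>V. (y i)\<^sup>2 / N y)"
      using pos unfolding N_def[of z] by (intro sum.cong) (auto simp: z_def power_divide)
    also have "\<dots> = 1"
      using pos by (simp add: N_def flip: sum_divide_distrib)
    finally have "z \<in> K"
      using pos by (auto simp: K_def z_def)
    have "q y \<le> (\<Sum>i\<in>V. \<Sum>j\<in>V. a i j * \<bar>y i\<bar> * \<bar>y j\<bar>)"
      unfolding q_def
    proof (intro sum_mono)
      fix i j assume "i \<in> V" "j \<in> V"
      then have "a i j * y i * y j \<le> \<bar>a i j * y i * y j\<bar>" by simp
      also have "\<dots> = a i j * \<bar>y i\<bar> * \<bar>y j\<bar>"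
        using nonneg[OF \<open>i \<in> V\<close> \<open>j \<in> V\<close>] by (simp add: abs_mult)
      finally show "a i j * y i * y j \<le> a i j * \<bar>y i\<bar> * \<bar>y j\<bar>" .
    qed
    also have "\<dots> = N y * q z"
      unfolding q_def sum_distrib_left
    proof (intro sum.cong refl)
      fix i j assume "i \<in> V" "j \<in> V"
      then show "a i j * \<bar>y i\<bar> * \<bar>y j\<bar> = N y * (a i j * z i * z j)"
        using pos by (simp add: z_def field_simps)
    qed
    also have "\<dots> \<le> N y * m"
      using max[OF \<open>z \<in> K\<close>] pos by (simp add: m_def)
    finally show ?thesis by (simp add: mult.commute)
  qed
  have x_props: "\<And>i. i \<in> V \<Longrightarrow> 0 \<le> x i" "N x = 1"
    using x by (auto simp: K_def)
  have eigen: "(\<Sum>j\<in>V. a k j * x j) = m * x k" if "k \<in> V" for k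
  proof -
    \<comment> \<open>The maximiser \<open>x\<close> is perturbed along the coordinate
      \<open>k\<close>. Because \<open>q x = m\<close> and \<open>N x = 1\<close>, the constant
      terms of the Rayleigh inequality cancel, and its linear coefficient is the defect of the
      eigenvector equation at \<open>k\<close>.\<close>
    define e where "e i = (if i = k then 1 else 0 :: real)" for i
    have "0 \<le> 2 * t * (m * x k - (\<Sum>j\<in>V. a k j * x j)) + t\<^sup>2 * (m - a k k)" for t
    proof -
      have "N (\<lambda>i. x i + t * e i) = (\<Sum>i\<in>V. (x i)\<^sup>2 + e i * (2 * t * x i + t\<^sup>2))"
        unfolding N_def by (intro sum.cong) (auto simp: e_def power2_eq_square algebra_simps)
      also have "\<dots> = 1 + 2 * t * x k + t\<^sup>2"
        using x_props(2) \<open>finite V\<close> \<open>k \<in> V\<close>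
        by (simp add: N_def sum.distrib e_def if_distrib[of "\<lambda>c. c * _"] del: distrib_left cong: if_cong)
      finally have N: "N (\<lambda>i. x i + t * e i) = 1 + 2 * t * x k + t\<^sup>2" .
      have "q (\<lambda>i. x i + t * e i) = (\<Sum>i\<in>V. \<Sum>j\<in>V. a i j * x i * x j
          + (e j * (t * (a i j * x i)) + e i * (t * (a i j * x j)) + e i * (e j * (t\<^sup>2 * a i j))))"
        unfolding q_def by (intro sum.cong) (auto simp: power2_eq_square algebra_simps)
      also have "\<dots> = q x + ((\<Sum>i\<in>V. \<Sum>j\<in>V. e j * (t * (a i j * x i)))
          + (\<Sum>i\<in>V. \<Sum>j\<in>V. e i * (t * (a i j * x j)))
          + (\<Sum>i\<in>V. \<Sum>j\<in>V. e i * (e j * (t\<^sup>2 * a i j))))"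
        by (simp add: q_def sum.distrib)
      \<comment> \<open>Symmetry of \<open>a\<close> turns this sum over column \<open>k\<close>
        into the sum over row \<open>k\<close>, so the two mixed terms agree.\<close>
      also have "(\<Sum>i\<in>V. \<Sum>j\<in>V. e j * (t * (a i j * x i))) = t * (\<Sum>j\<in>V. a k j * x j)"
      proof -
        have "(\<Sum>j\<in>V. e j * (t * (a i j * x i))) = t * (a k i * x i)" if "i \<in> V" for i
          using \<open>finite V\<close> \<open>k \<in> V\<close> sym[OF that \<open>k \<in> V\<close>]
          by (simp add: e_def if_distrib[of "\<lambda>c. c * _"] cong: if_cong)
        then show ?thesis by (simp add: sum_distrib_left)
      qed
      also have "(\<Sum>i\<in>V. \<Sum>j\<in>V. e i * (t * (a i j * x j))) = t * (\<Sum>j\<in>V. a k j * x j)"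
        using \<open>finite V\<close> \<open>k \<in> V\<close> unfolding sum_distrib_left[symmetric]
        by (simp add: e_def if_distrib[of "\<lambda>c. c * _"] cong: if_cong)
      also have "(\<Sum>i\<in>V. \<Sum>j\<in>V. e i * (e j * (t\<^sup>2 * a i j))) = t\<^sup>2 * a k k"
        using \<open>finite V\<close> \<open>k \<in> V\<close> unfolding sum_distrib_left[symmetric]
        by (simp add: e_def if_distrib[of "\<lambda>c. c * _"] cong: if_cong)
      finally have "q (\<lambda>i. x i + t * e i)
          = m + 2 * t * (\<Sum>j\<in>V. a k j * x j) + t\<^sup>2 * a k k"
        by (simp add: m_def)
      then show ?thesis
        using rayleigh[of "\<lambda>i. x i + t * e i"] unfolding N by (simp add: algebra_simps)
    qed
    then have "m * x k - (\<Sum>j\<in>V. a k j * x j) = 0"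
      by (rule nonneg_on_lin_quad_imp_zero)
    then show ?thesis by simp
  qed
  show ?thesis
  proof (rule that[of x m])
    show "\<exists>i\<in>V. x i \<noteq> 0"
    proof (rule ccontr)
      assume "\<not> (\<exists>i\<in>V. x i \<noteq> 0)"
      then have "N x = 0" by (simp add: N_def)
      with x_props(2) show False by simp
    qed
  qed (use x_props eigen rayleigh in \<open>auto simp: q_def N_def\<close>)
qed

section \<open>The largest eigenvalue of the generalized distance matrix\<close>

text \<open>Removes the numbering: eigenvectors become functions on the vertices, and all later sums
  run over the vertex set.\<close>

lemma eigenvalue_mat_nth_iff:
  assumes "distinct vs"
  shows "eigenvalue (mat (length vs) (length vs) (\<lambda>(i, j). a (vs ! i) (vs ! j))) k \<longleftrightarrow>
    (\<exists>y. (\<exists>u\<in>set vs. y u \<noteq> 0) \<and> (\<forall>u\<in>set vs. (\<Sum>v\<in>set vs. a u v * y v) = k * y u))"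
    (is "eigenvalue ?A k \<longleftrightarrow> (\<exists>y. ?P y)")
proof -
  have bij: "bij_betw ((!) vs) {0..<length vs} (set vs)"
    using assms by (intro bij_betw_nth) auto
  have step: "eigenvector ?A w k \<longleftrightarrow> ?P y"
    if w: "dim_vec w = length vs" "\<And>i. i < length vs \<Longrightarrow> w $ i = y (vs ! i)" for w y
  proof -
    have w0: "w = 0\<^sub>v (length vs) \<longleftrightarrow> (\<forall>u\<in>set vs. y u = 0)"
      using w by (simp add: vec_eq_iff all_set_conv_all_nth)
    have Aw: "(?A *\<^sub>v w) $ i = (\<Sum>v\<in>set vs. a (vs ! i) v * y v)" if "i < length vs" for i
      unfolding sum.reindex_bij_betw[OF bij, of "\<lambda>v. a (vs ! i) v * y v", symmetric]
      using that by (simp add: scalar_prod_def w)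
    have "?A *\<^sub>v w = k \<cdot>\<^sub>v w \<longleftrightarrow> (\<forall>i<length vs. (?A *\<^sub>v w) $ i = k * w $ i)"
      using w(1) unfolding vec_eq_iff by auto
    also have "\<dots> \<longleftrightarrow> (\<forall>i<length vs. (\<Sum>v\<in>set vs. a (vs ! i) v * y v) = k * y (vs ! i))"
      by (intro all_cong) (simp only: Aw w(2))
    also have "\<dots> \<longleftrightarrow> (\<forall>u\<in>set vs. (\<Sum>v\<in>set vs. a u v * y v) = k * y u)"
      by (rule all_set_conv_all_nth[symmetric])
    finally show ?thesis
      using w(1) w0 unfolding eigenvector_def carrier_vec_def by auto
  qed
  show ?thesis
  proof
    assume "eigenvalue ?A k"
    then obtain w where w: "eigenvector ?A w k" by (auto simp: eigenvalue_def)
    then have "w \<in> carrier_vec (dim_row ?A)"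
      unfolding eigenvector_def by (rule conjunct1)
    then have dim: "dim_vec w = length vs" by simp
    \<comment> \<open>As \<open>vs\<close> is distinct, each vertex has a unique index, at which its
      value is read off.\<close>
    define y where "y u = w $ inv_into {0..<length vs} ((!) vs) u" for u
    have nth: "w $ i = y (vs ! i)" if "i < length vs" for i
      using bij_betw_inv_into_left[OF bij, of i] that unfolding y_def by simp
    have "eigenvector ?A w k \<longleftrightarrow> ?P y"
      using dim nth by (rule step)
    then have "?P y" using w by (rule iffD1)
    then show "\<exists>y. ?P y" by (rule exI[of _ y])
  next
    assume "\<exists>y. ?P y"
    then obtain y where y: "?P y" by (rule exE)
    have "eigenvector ?A (vec (length vs) (\<lambda>i. y (vs ! i))) k"
      by (rule iffD2[OF step[where y = y] y]) simp_all
    then show "eigenvalue ?A k" unfolding eigenvalue_def by (rule exI)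
  qed
qed

text \<open>Eigenvalues are roots of the nonzero characteristic polynomial. Finiteness gives the
  \<open>Max\<close> in \<open>largest_eigenvalue\<close> its meaning.\<close>

lemma finite_eigenvalues:
  fixes A :: "'a :: field mat"
  assumes "A \<in> carrier_mat n n"
  shows "finite {k. eigenvalue A k}"
proof -
  have "char_poly A \<noteq> 0"
    using degree_monic_char_poly[OF assms] by auto
  then show ?thesis
    by (simp add: eigenvalue_root_char_poly[OF assms] poly_roots_finite)
qed

text \<open>The Rayleigh constant \<open>m\<close> is an eigenvalue and bounds all others, so it is
  the maximum. The diagonal bound is the Rayleigh estimate at an indicator function; it serves the
  case \<alpha> = 1, where the eigenvector may have zeros.\<close>

lemma largest_eigenvalue_symmetric_nonneg:
  fixes a :: "'a \<Rightarrow> 'a \<Rightarrow> real"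
  assumes "distinct vs" "vs \<noteq> []"
    and "\<And>u v. u \<in> set vs \<Longrightarrow> v \<in> set vs \<Longrightarrow> a u v = a v u"
    and "\<And>u v. u \<in> set vs \<Longrightarrow> v \<in> set vs \<Longrightarrow> 0 \<le> a u v"
  defines "\<rho> \<equiv> largest_eigenvalue (mat (length vs) (length vs) (\<lambda>(i, j). a (vs ! i) (vs ! j)))"
  obtains x where "\<forall>u\<in>set vs. 0 \<le> x u" "\<exists>u\<in>set vs. x u \<noteq> 0"
    "\<forall>u\<in>set vs. (\<Sum>v\<in>set vs. a u v * x v) = \<rho> * x u"
    "\<forall>u\<in>set vs. a u u \<le> \<rho>"
proof -
  let ?A = "mat (length vs) (length vs) (\<lambda>(i, j). a (vs ! i) (vs ! j))"
  have "finite (set vs)" "set vs \<noteq> {}" using \<open>vs \<noteq> []\<close> by auto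
  then obtain m x where x: "\<forall>u\<in>set vs. 0 \<le> x u" "\<exists>u\<in>set vs. x u \<noteq> 0"
    "\<forall>u\<in>set vs. (\<Sum>v\<in>set vs. a u v * x v) = m * x u"
    and rayleigh: "\<forall>y. (\<Sum>u\<in>set vs. \<Sum>v\<in>set vs. a u v * y u * y v) \<le> m * (\<Sum>u\<in>set vs. (y u)\<^sup>2)"
    by (rule symmetric_nonneg_top_eigenvector[OF _ _ assms(3,4)])
  have "k \<le> m" if k: "eigenvalue ?A k" for k
  proof -
    obtain y where y: "\<exists>u\<in>set vs. y u \<noteq> 0"
      "\<forall>u\<in>set vs. (\<Sum>v\<in>set vs. a u v * y v) = k * y u"
      using iffD1[OF eigenvalue_mat_nth_iff[OF \<open>distinct vs\<close>, of a] k] by (elim exE conjE)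
    \<comment> \<open>Pairing the eigenvector equation with \<open>y\<close> expresses
      \<open>k\<close> through the quadratic form, to which the Rayleigh bound applies.\<close>
    have "k * (\<Sum>u\<in>set vs. (y u)\<^sup>2) = (\<Sum>u\<in>set vs. y u * (\<Sum>v\<in>set vs. a u v * y v))"
      unfolding sum_distrib_left[of k]
      by (intro sum.cong refl) (simp add: y(2)[rule_format] power2_eq_square)
    also have "\<dots> = (\<Sum>u\<in>set vs. \<Sum>v\<in>set vs. a u v * y u * y v)"
      by (simp add: sum_distrib_left mult_ac)
    also have "\<dots> \<le> m * (\<Sum>u\<in>set vs. (y u)\<^sup>2)" using rayleigh by blast
    finally have "k * (\<Sum>u\<in>set vs. (y u)\<^sup>2) \<le> m * (\<Sum>u\<in>set vs. (y u)\<^sup>2)" .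
    moreover obtain w where "w \<in> set vs" "y w \<noteq> 0" using y(1) by blast
    then have "0 < (\<Sum>u\<in>set vs. (y u)\<^sup>2)"
      by (intro sum_pos2[of _ w]) auto
    ultimately show "k \<le> m" by simp
  qed
  moreover have "eigenvalue ?A m"
    using x(2,3) unfolding eigenvalue_mat_nth_iff[OF \<open>distinct vs\<close>, of a] by blast
  moreover have "finite {k. eigenvalue ?A k}"
    by (intro finite_eigenvalues[of _ "length vs"]) auto
  ultimately have "\<rho> = m"
    unfolding \<rho>_def largest_eigenvalue_def by (intro Max_eqI) auto
  have "a w w \<le> m" if "w \<in> set vs" for w
    using rayleigh[THEN spec, of "\<lambda>u. if u = w then 1 else 0"] that
    by (simp add: if_distrib[of "\<lambda>c. c\<^sup>2"] if_distrib[of "\<lambda>c. _ * c"] cong: if_cong)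
  with x show ?thesis
    by (intro that[of x]) (auto simp: \<open>\<rho> = m\<close>)
qed

section \<open>Entries and row sums of the generalized distance matrix\<close>

definition gen_distance :: "real \<Rightarrow> ('a, 'b) pre_digraph \<Rightarrow> 'a \<Rightarrow> 'a \<Rightarrow> real" where
  "gen_distance \<alpha> G u v = (if u = v then \<alpha> * transmission G u else 0) + (1 - \<alpha>) * gdist G u v"

text \<open>The matrix puts its diagonal part where indices agree, \<open>gen_distance\<close> where
  vertices agree; distinctness of \<open>vs\<close> identifies the two.\<close>

lemma gen_distance_mat_conv:
  assumes "distinct vs"
  shows "gen_distance_mat \<alpha> G vs =
    mat (length vs) (length vs) (\<lambda>(i, j). gen_distance \<alpha> G (vs ! i) (vs ! j))"
  using assms
  by (intro eq_matI) (auto simp: gen_distance_mat_def transmission_mat_def distance_mat_def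
      gen_distance_def mat_diag_def nth_eq_iff_index_eq)

lemma sum_gen_distance:
  assumes "finite (verts G)" "u \<in> verts G"
  shows "(\<Sum>v\<in>verts G. gen_distance \<alpha> G u v * f v)
    = \<alpha> * transmission G u * f u + (1 - \<alpha>) * (\<Sum>v\<in>verts G. gdist G u v * f v)"
  using assms
  by (simp add: gen_distance_def distrib_right sum.distrib sum_distrib_left mult.assoc
      if_distrib[of "\<lambda>c. c * _"] cong: if_cong)

text \<open>The case without diagonal part. With \<open>M\<close> and \<open>\<mu>\<close> the extreme transmissions, attained
  at \<open>i\<close> and \<open>k\<close>, constancy of the second transmission forces it to be \<open>M * \<mu>\<close>, whence every vertex
  other than \<open>i\<close> has transmission \<open>\<mu>\<close> and every vertex other than \<open>k\<close> has transmission \<open>M\<close>.\<close>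

lemma (in graph) second_transmission_const_imp_regular:
  assumes "connected G"
    and const: "\<And>u. u \<in> verts G \<Longrightarrow> second_transmission G u = c"
  shows "transmission_regular G"
proof -
  let ?Tr = "transmission G"
  have "verts G \<noteq> {}" using \<open>connected G\<close> by (auto simp: connected_def strongly_connected_def)
  have "Max (?Tr ` verts G) \<in> ?Tr ` verts G"
    using \<open>verts G \<noteq> {}\<close> by (intro Max_in) auto
  then obtain i where i_in: "i \<in> verts G" and i_eq: "Max (?Tr ` verts G) = ?Tr i" by blast
  have i: "?Tr v \<le> ?Tr i" if "v \<in> verts G" for v
    unfolding i_eq[symmetric] using that by simp
  have "Min (?Tr ` verts G) \<in> ?Tr ` verts G"
    using \<open>verts G \<noteq> {}\<close> by (intro Min_in) auto
  then obtain k where k_in: "k \<in> verts G" and k_eq: "Min (?Tr ` verts G) = ?Tr k" by blast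
  have k: "?Tr k \<le> ?Tr v" if "v \<in> verts G" for v
    unfolding k_eq[symmetric] using that by simp
  \<comment> \<open>The shift \<open>b\<close> is chosen to fix signs: at \<open>i\<close> with
    \<open>b = ?Tr k\<close> all terms are nonnegative, at \<open>k\<close> with
    \<open>b = ?Tr i\<close> all are nonpositive. This bounds \<open>c\<close> by the same product
    from both sides.\<close>
  have split: "(\<Sum>v\<in>verts G. gdist G u v * (?Tr v - b)) = c - b * ?Tr u" if "u \<in> verts G" for u b
    using const[OF that]
    by (simp add: second_transmission_def transmission_def[of G u] right_diff_distrib
        sum_subtractf sum_distrib_left mult.commute)
  have ge: "0 \<le> gdist G i v * (?Tr v - ?Tr k)" if "v \<in> verts G" for v
    using k[OF that] by (simp add: gdist_nonneg)
  have le: "0 \<le> gdist G k v * (?Tr i - ?Tr v)" if "v \<in> verts G" for v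
    using i[OF that] by (simp add: gdist_nonneg)
  have "(\<Sum>v\<in>verts G. gdist G k v * (?Tr i - ?Tr v)) = - (\<Sum>v\<in>verts G. gdist G k v * (?Tr v - ?Tr i))"
    by (simp add: right_diff_distrib flip: sum_negf)
  then have sum_k: "(\<Sum>v\<in>verts G. gdist G k v * (?Tr i - ?Tr v)) = ?Tr i * ?Tr k - c"
    using split[OF k_in] by simp
  note sum_i = split[OF i_in, of "?Tr k"]
  have "c = ?Tr i * ?Tr k"
    using sum_nonneg[of "verts G" "\<lambda>v. gdist G i v * (?Tr v - ?Tr k)"]
      sum_nonneg[of "verts G" "\<lambda>v. gdist G k v * (?Tr i - ?Tr v)"] ge le
    unfolding sum_i sum_k by (simp add: mult.commute)
  then have "(\<Sum>v\<in>verts G. gdist G i v * (?Tr v - ?Tr k)) = 0" "(\<Sum>v\<in>verts G. gdist G k v * (?Tr i - ?Tr v)) = 0"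
    unfolding sum_i sum_k by simp_all
  then have zero: "gdist G i v * (?Tr v - ?Tr k) = 0" "gdist G k v * (?Tr i - ?Tr v) = 0" if "v \<in> verts G" for v
    using sum_nonneg_0[where f = "\<lambda>v. gdist G i v * (?Tr v - ?Tr k)", OF finite_verts ge _ that]
      sum_nonneg_0[where f = "\<lambda>v. gdist G k v * (?Tr i - ?Tr v)", OF finite_verts le _ that]
    by simp_all
  \<comment> \<open>Distances between distinct vertices are positive, so the other factor of the
    vanishing term must be 0.\<close>
  have others: "?Tr v = ?Tr k" if "v \<in> verts G" "v \<noteq> i" for v
    using zero(1)[OF that(1)] gdist_pos[OF \<open>connected G\<close> i_in that(1)] that(2) by simp
  have others': "?Tr v = ?Tr i" if "v \<in> verts G" "v \<noteq> k" for v
    using zero(2)[OF that(1)] gdist_pos[OF \<open>connected G\<close> k_in that(1)] that(2) by simp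
  have "?Tr i = ?Tr k"
  \<comment> \<open>A third vertex has both extreme transmissions. With at most two vertices, each
    transmission is the one distance between them, or 0 for a single vertex.\<close>
  proof (cases "verts G \<subseteq> {i, k}")
    case True
    then have verts: "verts G = {i, k}" using i_in k_in by blast
    show ?thesis
      using i_in k_in by (cases "i = k") (auto simp: transmission_def verts gdist_self gdist_commute[of i k])
  next
    case False
    then obtain v where "v \<in> verts G" "v \<noteq> i" "v \<noteq> k" by blast
    then show ?thesis using others[of v] others'[of v] by simp
  qed
  then have "?Tr v = ?Tr k" if "v \<in> verts G" for v
    using i[OF that] k[OF that] by simp
  then show ?thesis by (simp add: transmission_regular_def)
qed

section \<open>The bound and its equality case\<close>

text \<open>Completing the square: the hypothesis places \<open>r\<close> to the right of the vertex
  of the parabola, where comparison with the larger root is decided by the sign of the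
  quadratic.\<close>

lemma quadratic_root_le_iff:
  fixes p q r :: real
  assumes "p \<le> 2 * r"
  shows "(p + sqrt (p\<^sup>2 + 4 * q)) / 2 \<le> r \<longleftrightarrow> 0 \<le> r\<^sup>2 - p * r - q"
    and "0 \<le> p\<^sup>2 + 4 * q \<Longrightarrow> r = (p + sqrt (p\<^sup>2 + 4 * q)) / 2 \<longleftrightarrow> r\<^sup>2 - p * r - q = 0"
proof -
  have r: "sqrt ((2 * r - p)\<^sup>2) = 2 * r - p" using assms by simp
  have d: "(2 * r - p)\<^sup>2 = 4 * (r\<^sup>2 - p * r - q) + (p\<^sup>2 + 4 * q)"
    by (simp add: power2_eq_square algebra_simps)
  have "(p + sqrt (p\<^sup>2 + 4 * q)) / 2 \<le> r \<longleftrightarrow> sqrt (p\<^sup>2 + 4 * q) \<le> sqrt ((2 * r - p)\<^sup>2)"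
    unfolding r by (simp add: field_simps)
  then show "(p + sqrt (p\<^sup>2 + 4 * q)) / 2 \<le> r \<longleftrightarrow> 0 \<le> r\<^sup>2 - p * r - q"
    unfolding real_sqrt_le_iff d by argo
  have "r = (p + sqrt (p\<^sup>2 + 4 * q)) / 2 \<longleftrightarrow> sqrt (p\<^sup>2 + 4 * q) = sqrt ((2 * r - p)\<^sup>2)"
    unfolding r by (auto simp: field_simps)
  then show "r = (p + sqrt (p\<^sup>2 + 4 * q)) / 2 \<longleftrightarrow> r\<^sup>2 - p * r - q = 0"
    unfolding real_sqrt_eq_iff d by argo
qed

theorem theorem4p2:
  fixes G :: "('a, 'b) pre_digraph" and vs :: "'a list" and \<alpha> :: real
  assumes "graph G" and "connected G"
    and "distinct vs" and "set vs = verts G"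
    and "0 \<le> \<alpha>" and "\<alpha> \<le> 1"
  defines "\<rho> \<equiv> largest_eigenvalue (gen_distance_mat \<alpha> G vs)"
    and "bound \<equiv> (\<alpha> * transmission_min G +
      sqrt (\<alpha>\<^sup>2 * (transmission_min G)\<^sup>2 + 4 * (1 - \<alpha>) * second_transmission_min G)) / 2"
  shows "\<rho> \<ge> bound \<and> (\<rho> = bound \<longleftrightarrow> transmission_regular G)"
proof -
  interpret graph G by fact
  let ?V = "verts G" and ?a = "gen_distance \<alpha> G"
  let ?Tr = "transmission G" and ?T = "second_transmission G"
  define \<mu>0 where "\<mu>0 = transmission_min G"
  define \<tau> where "\<tau> = second_transmission_min G"
  have ne: "?V \<noteq> {}" using \<open>connected G\<close> by (auto simp: connected_def strongly_connected_def)
  have Tr_nonneg: "0 \<le> ?Tr u" for u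
    by (simp add: transmission_def sum_nonneg gdist_nonneg)
  have T_nonneg: "0 \<le> ?T u" for u
    by (simp add: second_transmission_def sum_nonneg gdist_nonneg Tr_nonneg)
  have Tr_ge: "\<mu>0 \<le> ?Tr u" and T_ge: "\<tau> \<le> ?T u" if "u \<in> ?V" for u
    using that by (simp_all add: \<mu>0_def \<tau>_def transmission_min_def second_transmission_min_def)
  have "0 \<le> \<mu>0" "0 \<le> \<tau>"
    using ne Tr_nonneg T_nonneg
    by (simp_all add: \<mu>0_def \<tau>_def transmission_min_def second_transmission_min_def)

  have a_sym: "?a u v = ?a v u" for u v
    by (simp add: gen_distance_def gdist_commute[of u v])
  have a_nonneg: "0 \<le> ?a u v" for u v
    using assms(5,6) by (simp add: gen_distance_def gdist_nonneg Tr_nonneg)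
  have "vs \<noteq> []" using ne assms(4) by auto
  obtain x where "\<forall>u\<in>?V. 0 \<le> x u" and x_nz: "\<exists>u\<in>?V. x u \<noteq> 0"
    and "\<forall>u\<in>?V. (\<Sum>v\<in>?V. ?a u v * x v) = \<rho> * x u"
    and "\<forall>u\<in>?V. ?a u u \<le> \<rho>"
    unfolding \<rho>_def gen_distance_mat_conv[OF assms(3)] assms(4)[symmetric]
    by (rule largest_eigenvalue_symmetric_nonneg[OF assms(3) \<open>vs \<noteq> []\<close> a_sym a_nonneg])
  then have x_nonneg: "0 \<le> x u" and eigen: "(\<Sum>v\<in>?V. ?a u v * x v) = \<rho> * x u"
    and diag: "?a u u \<le> \<rho>" if "u \<in> ?V" for u
    using that by blast+
  \<comment> \<open>By symmetry the matrix moves from \<open>f\<close> onto its eigenvector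
    \<open>x\<close>. Taking \<open>f\<close> constant 1 and then \<open>?Tr\<close> yields the
    \<open>x\<close>-weighted row sums of A and of A^2.\<close>
  have adjoint: "(\<Sum>u\<in>?V. x u * (\<Sum>v\<in>?V. ?a u v * f v)) = \<rho> * (\<Sum>u\<in>?V. x u * f u)" for f
  proof -
    have "(\<Sum>u\<in>?V. x u * (\<Sum>v\<in>?V. ?a u v * f v)) = (\<Sum>v\<in>?V. \<Sum>u\<in>?V. ?a u v * x u * f v)"
      unfolding sum_distrib_left by (subst sum.swap) (simp add: mult_ac)
    also have "\<dots> = (\<Sum>v\<in>?V. (\<Sum>u\<in>?V. ?a v u * x u) * f v)"
      by (simp add: sum_distrib_right a_sym)
    also have "\<dots> = \<rho> * (\<Sum>u\<in>?V. x u * f u)"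
      by (simp add: eigen sum_distrib_left mult.assoc)
    finally show ?thesis .
  qed

  define S where "S = (\<Sum>u\<in>?V. x u)"
  have "0 < S"
  proof -
    obtain w where "w \<in> ?V" "0 < x w" using x_nz x_nonneg by force
    then show ?thesis unfolding S_def by (intro sum_pos2[of _ w]) (auto simp: x_nonneg)
  qed
  \<comment> \<open>The row sums of A form the vector \<open>?Tr\<close>, so applying A to
    \<open>?Tr\<close> in \<open>row2\<close> gives the row sums of A^2.\<close>
  have row1: "(\<Sum>v\<in>?V. ?a u v) = ?Tr u" if "u \<in> ?V" for u
    using sum_gen_distance[of G u \<alpha> "\<lambda>_. 1"] that
    by (simp add: left_diff_distrib flip: transmission_def[of G u])
  have row2: "(\<Sum>v\<in>?V. ?a u v * ?Tr v) = \<alpha> * (?Tr u)\<^sup>2 + (1 - \<alpha>) * ?T u" if "u \<in> ?V" for u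
    using that by (simp add: sum_gen_distance second_transmission_def power2_eq_square)
  have sum1: "(\<Sum>u\<in>?V. x u * ?Tr u) = \<rho> * S"
    using adjoint[of "\<lambda>_. 1"] by (simp add: row1 S_def)
  have sum2: "(\<Sum>u\<in>?V. x u * (\<alpha> * (?Tr u)\<^sup>2 + (1 - \<alpha>) * ?T u)) = \<rho>\<^sup>2 * S"
    using adjoint[of ?Tr] by (simp add: row2 sum1 power2_eq_square)

  \<comment> \<open>The slack in the row inequality for A^2, split into two nonnegative parts so
    that its vanishing forces each part to vanish.\<close>
  define g where "g u = \<alpha> * ?Tr u * (?Tr u - \<mu>0) + (1 - \<alpha>) * (?T u - \<tau>)" for u
  have parts: "0 \<le> \<alpha> * ?Tr u * (?Tr u - \<mu>0)" "0 \<le> (1 - \<alpha>) * (?T u - \<tau>)" if "u \<in> ?V" for u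
    using Tr_ge[OF that] T_ge[OF that] Tr_nonneg assms(5,6) by simp_all
  have g_nonneg: "0 \<le> g u" if "u \<in> ?V" for u
    using parts[OF that] by (simp add: g_def)
  have "(\<Sum>u\<in>?V. x u * g u) = (\<Sum>u\<in>?V. x u * (\<alpha> * (?Tr u)\<^sup>2 + (1 - \<alpha>) * ?T u)
      - \<alpha> * \<mu>0 * (x u * ?Tr u) - (1 - \<alpha>) * \<tau> * x u)"
    by (intro sum.cong) (auto simp: g_def power2_eq_square algebra_simps)
  also have "\<dots> = \<rho>\<^sup>2 * S - \<alpha> * \<mu>0 * (\<rho> * S) - (1 - \<alpha>) * \<tau> * S"
    by (simp only: sum_subtractf sum2 sum1 S_def flip: sum_distrib_left)
  finally have excess: "(\<Sum>u\<in>?V. x u * g u) = (\<rho>\<^sup>2 - \<alpha> * \<mu>0 * \<rho> - (1 - \<alpha>) * \<tau>) * S"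
    by (simp add: algebra_simps)

  \<comment> \<open>\<rho> is an \<open>x\<close>-weighted average of the transmissions, hence at
    least their minimum. This places \<rho> on the side of the larger root, as
    \<open>quadratic_root_le_iff\<close> requires.\<close>
  have "\<mu>0 * S \<le> \<rho> * S"
    unfolding sum1[symmetric] unfolding S_def sum_distrib_left
    by (intro sum_mono) (auto simp: mult.commute[of \<mu>0] intro!: mult_left_mono Tr_ge x_nonneg)
  then have "\<mu>0 \<le> \<rho>" using \<open>0 < S\<close> by simp
  moreover have "\<alpha> * \<mu>0 \<le> \<mu>0" using assms(6) \<open>0 \<le> \<mu>0\<close> by (simp add: mult_left_le_one_le assms(5))
  ultimately have "\<alpha> * \<mu>0 \<le> 2 * \<rho>" using \<open>0 \<le> \<mu>0\<close> by linarith
  have bound: "bound = (\<alpha> * \<mu>0 + sqrt ((\<alpha> * \<mu>0)\<^sup>2 + 4 * ((1 - \<alpha>) * \<tau>))) / 2"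
    by (simp add: bound_def \<mu>0_def \<tau>_def power_mult_distrib)
  have ge: "bound \<le> \<rho>"
  proof -
    have "0 \<le> (\<Sum>u\<in>?V. x u * g u)" by (intro sum_nonneg mult_nonneg_nonneg x_nonneg g_nonneg)
    then have "0 \<le> \<rho>\<^sup>2 - \<alpha> * \<mu>0 * \<rho> - (1 - \<alpha>) * \<tau>"
      using \<open>0 < S\<close> by (simp add: excess zero_le_mult_iff)
    then show ?thesis
      unfolding bound using quadratic_root_le_iff(1)[OF \<open>\<alpha> * \<mu>0 \<le> 2 * \<rho>\<close>] by simp
  qed
  have "0 \<le> (\<alpha> * \<mu>0)\<^sup>2 + 4 * ((1 - \<alpha>) * \<tau>)"
    using \<open>0 \<le> \<tau>\<close> assms(6) by simp
  then have "\<rho> = bound \<longleftrightarrow> \<rho>\<^sup>2 - \<alpha> * \<mu>0 * \<rho> - (1 - \<alpha>) * \<tau> = 0"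
    unfolding bound by (rule quadratic_root_le_iff(2)[OF \<open>\<alpha> * \<mu>0 \<le> 2 * \<rho>\<close>])
  also have "\<dots> \<longleftrightarrow> (\<Sum>u\<in>?V. x u * g u) = 0"
    using \<open>0 < S\<close> by (simp add: excess)
  finally have eq_iff: "\<rho> = bound \<longleftrightarrow> (\<forall>u\<in>?V. x u * g u = 0)"
    by (subst (asm) sum_nonneg_eq_0_iff) (auto intro!: mult_nonneg_nonneg x_nonneg g_nonneg)

  have "transmission_regular G" if eq: "\<rho> = bound"
  proof (cases "\<alpha> = 1")
    \<comment> \<open>The bound is now the minimum transmission, while every transmission is a
      diagonal entry and so at most \<rho>.\<close>
    case True
    then have "\<rho> = \<mu>0" using eq \<open>0 \<le> \<mu>0\<close> by (simp add: bound)
    then have "?Tr u = \<mu>0" if "u \<in> ?V" for u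
      using diag[OF that] Tr_ge[OF that] True by (simp add: gen_distance_def)
    then show ?thesis by (simp add: transmission_regular_def)
  next
    case False
    then have "\<alpha> < 1" using assms(6) by simp
    \<comment> \<open>For \<alpha> < 1 all off-diagonal entries are positive, so a zero of
      \<open>x\<close> at \<open>u\<close> makes row \<open>u\<close> of the eigenvector equation
      force \<open>x\<close> to vanish everywhere.\<close>
    have x_pos: "x u \<noteq> 0" if "u \<in> ?V" for u
    proof
      assume "x u = 0"
      then have "(\<Sum>v\<in>?V. ?a u v * x v) = 0" using eigen[OF that] by simp
      then have "\<forall>v\<in>?V. ?a u v * x v = 0"
        by (subst (asm) sum_nonneg_eq_0_iff) (auto intro!: mult_nonneg_nonneg x_nonneg a_nonneg)
      moreover have "?a u v > 0" if "v \<in> ?V" "v \<noteq> u" for v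
        using that gdist_pos[OF assms(2) \<open>u \<in> ?V\<close> that(1)] \<open>\<alpha> < 1\<close> by (simp add: gen_distance_def)
      ultimately have "x v = 0" if "v \<in> ?V" for v
        using that \<open>x u = 0\<close> by (cases "v = u") force+
      then show False using x_nz by blast
    qed
    have g0: "g u = 0" if "u \<in> ?V" for u
      using eq eq_iff x_pos that by auto
    have T_const: "?T u = \<tau>" if "u \<in> ?V" for u
    proof -
      have "(1 - \<alpha>) * (?T u - \<tau>) = 0"
        using g0[OF that] parts[OF that] unfolding g_def by linarith
      then show ?thesis using \<open>\<alpha> < 1\<close> by simp
    qed
    then show ?thesis
      using assms(2) by (intro second_transmission_const_imp_regular)
  qed
  moreover have "\<rho> = bound" if reg: "transmission_regular G"
  proof -
    have Tr: "?Tr u = \<mu>0" if "u \<in> ?V" for u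
    proof -
      have "?Tr u \<le> ?Tr v" if "v \<in> ?V" for v
        using reg \<open>u \<in> ?V\<close> that unfolding transmission_regular_def by (metis order_refl)
      then have "Min (?Tr ` ?V) = ?Tr u"
        using that by (intro Min_eqI) auto
      then show ?thesis by (simp add: \<mu>0_def transmission_min_def)
    qed
    \<comment> \<open>A constant transmission factors out of the sum, so both minima are attained at
      every vertex and \<open>g\<close> vanishes on the whole vertex set.\<close>
    have T: "?T u = \<mu>0\<^sup>2" if "u \<in> ?V" for u
    proof -
      have "?T u = (\<Sum>v\<in>?V. gdist G u v * \<mu>0)"
        by (simp add: second_transmission_def Tr)
      also have "\<dots> = ?Tr u * \<mu>0"
        by (simp add: transmission_def sum_distrib_right)
      finally show ?thesis using Tr[OF that] by (simp add: power2_eq_square)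
    qed
    then have "?T ` ?V = {\<mu>0\<^sup>2}" using ne by auto
    then have "\<tau> = \<mu>0\<^sup>2" by (simp add: \<tau>_def second_transmission_min_def)
    then show ?thesis by (simp add: eq_iff g_def Tr T)
  qed
  ultimately show ?thesis using ge by blast
qed

end
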